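(* Let $(X,C)$ and $(Y,K)$ be Archimedean partially ordered vector spaces and suppose that $f\colon C\to K$ is an order-isomorphism. Let $(v_\alpha)_{\alpha\in A}$ be a collection of linearly independent extreme vectors in $C$. Then there exist monotone increasing bijections $g_\alpha\colon[0,\infty)\to[0,\infty)$, for $\alpha\in A$, such that for all $\lambda_1,\ldots,\lambda_n\ge 0$ and all pairwise distinct $\alpha_1,\ldots,\alpha_n\in A$ we have $$f\left(\sum_{i=1}^n\lambda_i v_{\alpha_i}\right)=\sum_{i=1}^n g_{\alpha_i}(\lambda_i)f(v_{\alpha_i}).$$
   Context: A partially ordered vector space $(X,C)$ is a real vector space $X$ with a cone $C$ ($C$ convex, $\lambda C\subseteq C$ for $\lambda\ge 0$, $C\cap(-C)=\{0\}$), ordered by $x\le y$ iff $y-x\in C$. It is Archimedean if, whenever $x\in X$, $y\in C$ and $nx\le y$ for all integers $n\ge1$, then $x\le 0$. An order-isomorphism is an order preserving bijection whose inverse is also order preserving. A vector $e\in C\setminus\{0\}$ is an extreme vector in $C$ if $0\le x\le e$ implies $x=\lambda e$ for some $\lambda\ge 0$. *)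

theory Defs
  imports "HOL-Analysis.Analysis"
begin

definition cone_le :: "'a::real_vector set \<Rightarrow> 'a \<Rightarrow> 'a \<Rightarrow> bool" where
  "cone_le C x y \<longleftrightarrow> y - x \<in> C"

(* The vector space is the whole type. The library predicate "cone" admits the
   empty set; the last conjunct excludes it. *)
definition partially_ordered_vs :: "'a::real_vector set \<Rightarrow> bool" where
  "partially_ordered_vs C \<longleftrightarrow> convex C \<and> cone C \<and> C \<inter> uminus ` C = {0}"

definition archimedean_vs :: "'a::real_vector set \<Rightarrow> bool" where
  "archimedean_vs C \<longleftrightarrow>
    (\<forall>x. \<forall>y\<in>C. (\<forall>n::nat. n \<ge> 1 \<longrightarrow> cone_le C (real n *\<^sub>R x) y) \<longrightarrow> cone_le C x 0)"

(* D carries the order induced by the cone C, and the values of f are compared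
   in the order induced by the cone K. *)
definition order_preserving_on ::
  "'a set \<Rightarrow> 'a::real_vector set \<Rightarrow> 'b::real_vector set \<Rightarrow> ('a \<Rightarrow> 'b) \<Rightarrow> bool" where
  "order_preserving_on D C K f \<longleftrightarrow>
    (\<forall>x\<in>D. \<forall>y\<in>D. cone_le C x y \<longrightarrow> cone_le K (f x) (f y))"

definition cone_order_iso ::
  "'a::real_vector set \<Rightarrow> 'b::real_vector set \<Rightarrow> ('a \<Rightarrow> 'b) \<Rightarrow> bool" where
  "cone_order_iso C K f \<longleftrightarrow>
    bij_betw f C K \<and> order_preserving_on C C K f \<and> order_preserving_on K K C (inv_into C f)"

definition extreme_vector :: "'a::real_vector set \<Rightarrow> 'a \<Rightarrow> bool" where
  "extreme_vector C e \<longleftrightarrow>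
    e \<in> C - {0} \<and> (\<forall>x. cone_le C 0 x \<and> cone_le C x e \<longrightarrow> (\<exists>t\<ge>0. x = t *\<^sub>R e))"

(* Independence of a family, so repeated vectors are excluded. *)
definition independent_family :: "'i set \<Rightarrow> ('i \<Rightarrow> 'a::real_vector) \<Rightarrow> bool" where
  "independent_family A v \<longleftrightarrow> inj_on v A \<and> independent (v ` A)"

end

theory Submission
  imports Defs
begin

text \<open>
  In an Archimedean space the extreme vectors \<open>e\<close> are exactly those for which \<open>[0, e]\<close> is a chain, so
  order-isomorphisms of cones map extreme rays bijectively and monotonically onto extreme rays.
  For every \<open>x \<in> C\<close> the map \<open>y \<mapsto> f (x + y) - f x\<close> is again an order-isomorphism; by induction on the
  number of summands everything therefore reduces to \<open>f (u + v) = f u + f v\<close> for non-parallel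
  extreme vectors \<open>u\<close>, \<open>v\<close>.  The two families of half-lines in the quadrant spanned by \<open>u\<close> and \<open>v\<close>
  are mapped to extreme half-lines, so the image of the quadrant is a doubly ruled surface.  The
  lines of one family induce a projective map between two lines of the other one; it fixes \<open>0\<close> and
  \<open>\<infinity>\<close>, so it is linear, and then the Archimedean property makes the two lines parallel.
\<close>

section \<open>Cone arithmetic and extreme vectors in one Archimedean space\<close>

locale archimedean_cone =
  fixes C :: "'a::real_vector set"
  assumes po: "partially_ordered_vs C" and arch: "archimedean_vs C"
begin

lemma zero_mem [simp]: "0 \<in> C"
  using po unfolding partially_ordered_vs_def by auto

lemma scale_mem: "x \<in> C \<Longrightarrow> 0 \<le> t \<Longrightarrow> t *\<^sub>R x \<in> C"
  using po unfolding partially_ordered_vs_def cone_def by auto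

lemma add_mem: "x \<in> C \<Longrightarrow> y \<in> C \<Longrightarrow> x + y \<in> C"
  using po unfolding partially_ordered_vs_def by (metis convex_cone)

lemma pointed: "x \<in> C \<Longrightarrow> - x \<in> C \<Longrightarrow> x = 0"
proof -
  assume "x \<in> C" "- x \<in> C"
  then have "x \<in> C \<inter> uminus ` C"
    by (metis IntI image_eqI minus_minus)
  then show ?thesis
    using po unfolding partially_ordered_vs_def by auto
qed

lemma archimedean:
  assumes "y \<in> C" "\<And>n::nat. n \<ge> 1 \<Longrightarrow> y - real n *\<^sub>R x \<in> C"
  shows "- x \<in> C"
  using arch assms unfolding archimedean_vs_def cone_le_def by fastforce

lemma extremeD:
  assumes "extreme_vector C e"
  shows "e \<in> C" "e \<noteq> 0"
  using assms unfolding extreme_vector_def by auto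

lemma extreme_below_multiple:
  assumes e: "extreme_vector C e" and x: "x \<in> C" "t *\<^sub>R e - x \<in> C" and t: "0 \<le> t"
  shows "\<exists>s\<ge>0. x = s *\<^sub>R e"
proof (cases "t = 0")
  case True
  then show ?thesis using x pointed by auto
next
  case False
  have "(1/t) *\<^sub>R x \<in> C" "(1/t) *\<^sub>R (t *\<^sub>R e - x) \<in> C"
    using x t by (auto intro: scale_mem)
  moreover have "(1/t) *\<^sub>R (t *\<^sub>R e - x) = e - (1/t) *\<^sub>R x"
    using False by (simp add: algebra_simps)
  ultimately obtain s where "s \<ge> 0" "(1/t) *\<^sub>R x = s *\<^sub>R e"
    using e unfolding extreme_vector_def cone_le_def by auto
  then have "t *\<^sub>R (1/t) *\<^sub>R x = (t * s) *\<^sub>R e" by simp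
  then have "x = (t * s) *\<^sub>R e" using False by simp
  then show ?thesis using \<open>s \<ge> 0\<close> t by (intro exI[of _ "t * s"]) auto
qed

lemma scale_mem_iff:
  assumes "extreme_vector C e"
  shows "t *\<^sub>R e \<in> C \<longleftrightarrow> 0 \<le> t"
proof
  assume "t *\<^sub>R e \<in> C"
  show "0 \<le> t"
  proof (rule ccontr)
    assume "\<not> 0 \<le> t"
    then have "(-1/t) *\<^sub>R (t *\<^sub>R e) \<in> C"
      by (intro scale_mem[OF \<open>t *\<^sub>R e \<in> C\<close>]) (simp add: field_simps)
    then have "- e \<in> C" using \<open>\<not> 0 \<le> t\<close> by auto
    then show False using pointed extremeD[OF assms] by auto
  qed
qed (use scale_mem extremeD assms in auto)

lemma extreme_scale:
  assumes e: "extreme_vector C e" and t: "0 < t"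
  shows "extreme_vector C (t *\<^sub>R e)"
  unfolding extreme_vector_def cone_le_def
proof (intro conjI allI impI)
  show "t *\<^sub>R e \<in> C - {0}" using extremeD[OF e] t by (auto intro: scale_mem)
next
  fix x assume "x - 0 \<in> C \<and> t *\<^sub>R e - x \<in> C"
  then obtain s where "s \<ge> 0" "x = s *\<^sub>R e"
    using extreme_below_multiple[OF e, of x t] t by auto
  then show "\<exists>r\<ge>0. x = r *\<^sub>R t *\<^sub>R e"
    using t by (intro exI[of _ "s / t"]) auto
qed

text \<open>The coefficient of \<open>x\<close> is the supremum \<open>m\<close> of all
  \<open>t\<close> with \<open>t *\<^sub>R e\<close> below \<open>x\<close>, and the Archimedean
  property removes the gap of \<open>1 / n\<close> on both sides. The criterion speaks of the order
  alone, so it can be carried through an order-isomorphism.\<close>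

lemma extreme_if_chain:
  assumes e: "e \<in> C" "e \<noteq> 0"
    and chain: "\<And>x y. x \<in> C \<Longrightarrow> y \<in> C \<Longrightarrow> e - x \<in> C \<Longrightarrow> e - y \<in> C \<Longrightarrow> y - x \<in> C \<or> x - y \<in> C"
  shows "extreme_vector C e"
  unfolding extreme_vector_def cone_le_def
proof (intro conjI allI impI)
  fix x assume "x - 0 \<in> C \<and> e - x \<in> C"
  then have x: "x \<in> C" "e - x \<in> C" by auto
  define S where "S = {t. 0 \<le> t \<and> t \<le> 1 \<and> x - t *\<^sub>R e \<in> C}"
  define m where "m = Sup S"
  have S0: "0 \<in> S" using x by (auto simp: S_def)
  have bdd: "bdd_above S" by (auto simp: S_def bdd_above_def)
  have m0: "0 \<le> m" unfolding m_def by (rule cSup_upper[OF S0 bdd])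
  have "m *\<^sub>R e - x \<in> C"
  proof -
    have "e - real n *\<^sub>R (x - m *\<^sub>R e) \<in> C" if n: "n \<ge> 1" for n
    proof -
      \<comment> \<open>This \<open>t\<close> lies just above the supremum, so the chain condition
        puts \<open>x\<close> below \<open>t *\<^sub>R e\<close>. Multiplying by \<open>n\<close>
        turns \<open>1 / n\<close> into one full copy of \<open>e\<close>.\<close>
      define t where "t = m + 1 / real n"
      have tm: "t > m" using n by (simp add: t_def)
      then have tS: "t \<notin> S" using cSup_upper[OF _ bdd, of t] unfolding m_def by auto
      have "t *\<^sub>R e - x \<in> C"
      \<comment> \<open>The chain condition only covers elements below \<open>e\<close>; for
        \<open>t > 1\<close> the bound follows from \<open>x \<le> e\<close>.\<close>
      proof (cases "t \<le> 1")
        case True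
        have "t *\<^sub>R e \<in> C" using e tm m0 by (auto intro: scale_mem)
        moreover have "e - t *\<^sub>R e \<in> C"
          using scale_mem[OF e(1), of "1-t"] True by (simp add: algebra_simps)
        ultimately have "x - t *\<^sub>R e \<in> C \<or> t *\<^sub>R e - x \<in> C" using chain x by blast
        then show ?thesis using tS True tm m0 by (auto simp: S_def)
      next
        case False
        then have "(t - 1) *\<^sub>R e + (e - x) \<in> C" using e x by (auto intro!: add_mem scale_mem)
        then show ?thesis by (simp add: algebra_simps)
      qed
      then have "real n *\<^sub>R (t *\<^sub>R e - x) \<in> C" by (rule scale_mem) simp
      moreover have "real n *\<^sub>R (t *\<^sub>R e - x) = e - real n *\<^sub>R (x - m *\<^sub>R e)"
        using n by (simp add: t_def algebra_simps)
      ultimately show ?thesis by simp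
    qed
    from archimedean[OF e(1) this] show ?thesis by simp
  qed
  moreover have "x - m *\<^sub>R e \<in> C"
  proof -
    have "e - real n *\<^sub>R (m *\<^sub>R e - x) \<in> C" if n: "n \<ge> 1" for n
    proof -
      have "m - 1 / real n < Sup S" using n by (simp add: m_def)
      then obtain t where t: "t \<in> S" "m - 1 / real n < t"
        using less_cSup_iff[OF _ bdd] S0 by auto
      then have "(x - t *\<^sub>R e) + (t - (m - 1 / real n)) *\<^sub>R e \<in> C"
        using e by (auto intro!: add_mem scale_mem simp: S_def)
      then have "real n *\<^sub>R ((x - t *\<^sub>R e) + (t - (m - 1 / real n)) *\<^sub>R e) \<in> C"
        by (rule scale_mem) simp
      moreover have "real n *\<^sub>R ((x - t *\<^sub>R e) + (t - (m - 1 / real n)) *\<^sub>R e)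
          = e - real n *\<^sub>R (m *\<^sub>R e - x)"
        using n by (simp add: algebra_simps)
      ultimately show ?thesis by simp
    qed
    from archimedean[OF e(1) this] show ?thesis by simp
  qed
  ultimately have "x - m *\<^sub>R e = 0" using pointed[of "x - m *\<^sub>R e"] by simp
  then show "\<exists>t\<ge>0. x = t *\<^sub>R e" using m0 by auto
qed (use e in auto)

text \<open>The other summand is in the cone, so \<open>x *\<^sub>R p\<close> lies below a multiple
  of the extreme vector \<open>e\<close>.\<close>

lemma nonneg_combination_parallel:
  assumes e: "extreme_vector C e" "p \<in> C" "q \<in> C"
    and eq: "x *\<^sub>R p + y *\<^sub>R q = z *\<^sub>R e" and pos: "0 < x" "0 \<le> y" "0 \<le> z"
  shows "\<exists>t. p = t *\<^sub>R e"
proof -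
  have "z *\<^sub>R e - x *\<^sub>R p = y *\<^sub>R q" using eq by (simp add: algebra_simps)
  then have "z *\<^sub>R e - x *\<^sub>R p \<in> C" "x *\<^sub>R p \<in> C" using e pos by (auto intro: scale_mem)
  then obtain s where "x *\<^sub>R p = s *\<^sub>R e" using extreme_below_multiple e pos by blast
  then have "(1/x) *\<^sub>R (x *\<^sub>R p) = (s/x) *\<^sub>R e" by simp
  then have "p = (s/x) *\<^sub>R e" using pos by simp
  then show ?thesis ..
qed

lemma parallel_sym:
  fixes a b :: 'a
  assumes "a = t *\<^sub>R b" "a \<noteq> 0"
  shows "b = (1/t) *\<^sub>R a"
  using assms by auto

text \<open>Moving the negative terms of a relation to the other side leaves at most one vector
  alone on one side. As it is extreme, it would be parallel to a summand on the other side. It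
  serves to compare coefficients in \<open>iso_add_parallel\<close>.\<close>

lemma extreme_triple_independent:
  assumes e: "extreme_vector C a" "extreme_vector C b" "extreme_vector C c"
    and np: "\<And>t. a \<noteq> t *\<^sub>R b" "\<And>t. a \<noteq> t *\<^sub>R c" "\<And>t. b \<noteq> t *\<^sub>R c"
    and eq: "x *\<^sub>R a + y *\<^sub>R b + z *\<^sub>R c = 0"
  shows "x = 0 \<and> y = 0 \<and> z = 0"
proof -
  have np': "\<And>t. b \<noteq> t *\<^sub>R a" "\<And>t. c \<noteq> t *\<^sub>R a" "\<And>t. c \<noteq> t *\<^sub>R b"
    using np parallel_sym extremeD(2) e by metis+
  have mem: "a \<in> C" "b \<in> C" "c \<in> C" using e extremeD by auto
  have pos: False
    if "x *\<^sub>R a + y *\<^sub>R b + z *\<^sub>R c = 0" "0 \<le> x" "0 \<le> y" "0 < x \<or> 0 < y" for x y z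
  proof -
    have xy: "x *\<^sub>R a + y *\<^sub>R b = (-z) *\<^sub>R c" "y *\<^sub>R b + x *\<^sub>R a = (-z) *\<^sub>R c"
      using that(1) by (simp_all add: add_eq_0_iff2 add.commute)
    have "x *\<^sub>R a + y *\<^sub>R b \<in> C" using mem that by (intro add_mem scale_mem)
    then have "0 \<le> - z" using xy scale_mem_iff[OF e(3)] by metis
    then show False
      using nonneg_combination_parallel[OF e(3) mem(1,2) xy(1)]
        nonneg_combination_parallel[OF e(3) mem(2,1) xy(2)] that np by auto
  qed
  \<comment> \<open>For opposite signs of \<open>x\<close> and \<open>y\<close>, the sign of
    \<open>z\<close> decides whether \<open>b\<close> or \<open>a\<close> stands alone.\<close>
  have pos2: False
    if "x *\<^sub>R a + y *\<^sub>R b + z *\<^sub>R c = 0" "0 \<le> x" "y \<le> 0" "0 < x \<or> y < 0" for x y z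
  proof (cases "0 \<le> z")
    case True
    have xz: "x *\<^sub>R a + z *\<^sub>R c = (-y) *\<^sub>R b" "z *\<^sub>R c + x *\<^sub>R a = (-y) *\<^sub>R b"
      using that(1) by (simp_all add: algebra_simps add_eq_0_iff2)
    have "0 < x \<or> 0 < z"
    proof (rule ccontr)
      assume "\<not> (0 < x \<or> 0 < z)"
      then have "x = 0" "z = 0" using that True by auto
      then show False using that extremeD[OF e(2)] by auto
    qed
    then show False
      using nonneg_combination_parallel[OF e(2) mem(1,3) xz(1)]
        nonneg_combination_parallel[OF e(2) mem(3,1) xz(2)] that True np np' by auto
  next
    case False
    have zy: "(-z) *\<^sub>R c + (-y) *\<^sub>R b = x *\<^sub>R a"
      using that(1) by (simp add: algebra_simps add_eq_0_iff2)
    show False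
      using nonneg_combination_parallel[OF e(1) mem(3,2) zy] that False np'(2) by auto
  qed
  \<comment> \<open>Negating the relation reduces the remaining sign patterns to \<open>pos\<close>
    and \<open>pos2\<close>.\<close>
  have neg: "(-x) *\<^sub>R a + (-y) *\<^sub>R b + (-z) *\<^sub>R c = 0"
    using arg_cong[OF eq, of uminus] by (simp add: algebra_simps)
  have "x = 0 \<and> y = 0"
    using pos[OF eq] pos[OF neg] pos2[OF eq] pos2[OF neg]
    by (smt (verit))
  then show ?thesis using eq extremeD[OF e(3)] by auto
qed

end

section \<open>Order-isomorphisms as bijections that preserve and reflect the order\<close>

lemma cone_order_isoD:
  assumes "cone_order_iso C K f"
  shows "bij_betw f C K"
    and "\<And>x y. x \<in> C \<Longrightarrow> y \<in> C \<Longrightarrow> f y - f x \<in> K \<longleftrightarrow> y - x \<in> C"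
proof -
  show bij: "bij_betw f C K" using assms unfolding cone_order_iso_def by auto
  fix x y assume "x \<in> C" "y \<in> C"
  moreover have "f x \<in> K" "f y \<in> K" "inv_into C f (f x) = x" "inv_into C f (f y) = y"
    using bij calculation by (auto simp: bij_betw_def)
  ultimately show "f y - f x \<in> K \<longleftrightarrow> y - x \<in> C"
    using assms unfolding cone_order_iso_def order_preserving_on_def cone_le_def by metis
qed

lemma cone_order_isoI:
  assumes bij: "bij_betw f C K"
    and iff: "\<And>x y. x \<in> C \<Longrightarrow> y \<in> C \<Longrightarrow> f y - f x \<in> K \<longleftrightarrow> y - x \<in> C"
  shows "cone_order_iso C K f"
proof -
  have "inv_into C f y - inv_into C f x \<in> C" if "x \<in> K" "y \<in> K" "y - x \<in> K" for x y
  proof -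
    have "inv_into C f x \<in> C" "inv_into C f y \<in> C"
      "f (inv_into C f x) = x" "f (inv_into C f y) = y"
      using bij that by (auto simp: bij_betw_def inv_into_into f_inv_into_f)
    then show ?thesis using iff that by metis
  qed
  then show ?thesis
    using bij iff unfolding cone_order_iso_def order_preserving_on_def cone_le_def by auto
qed

lemma cone_order_iso_inv:
  assumes "cone_order_iso C K f"
  shows "cone_order_iso K C (inv_into C f)"
proof -
  note D = cone_order_isoD[OF assms]
  have bij: "bij_betw (inv_into C f) K C" using D(1) by (rule bij_betw_inv_into)
  show ?thesis
  proof (rule cone_order_isoI[OF bij])
    fix x y assume "x \<in> K" "y \<in> K"
    then have "inv_into C f x \<in> C" "inv_into C f y \<in> C"
      "f (inv_into C f x) = x" "f (inv_into C f y) = y"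
      using D(1) by (auto simp: bij_betw_def inv_into_into f_inv_into_f)
    then show "inv_into C f y - inv_into C f x \<in> C \<longleftrightarrow> y - x \<in> K" using D(2) by metis
  qed
qed

section \<open>Translates, extreme vectors and rays under an order-isomorphism\<close>

locale archimedean_cone_pair = C: archimedean_cone C + K: archimedean_cone K
  for C :: "'a::real_vector set" and K :: "'b::real_vector set"
begin

lemma iso_mem: "cone_order_iso C K f \<Longrightarrow> x \<in> C \<Longrightarrow> f x \<in> K"
  using cone_order_isoD(1) bij_betwE by blast

lemma iso_eq_iff: "cone_order_iso C K f \<Longrightarrow> x \<in> C \<Longrightarrow> y \<in> C \<Longrightarrow> f x = f y \<longleftrightarrow> x = y"
  using cone_order_isoD(1)[of C K f] by (auto simp: bij_betw_def inj_on_def)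

lemma iso_surj: "cone_order_iso C K f \<Longrightarrow> y \<in> K \<Longrightarrow> \<exists>x\<in>C. f x = y"
  using cone_order_isoD(1)[of C K f] by (auto simp: bij_betw_def)

lemma iso_zero:
  assumes f: "cone_order_iso C K f"
  shows "f 0 = 0"
proof -
  obtain x where x: "x \<in> C" "f x = 0" using iso_surj[OF f K.zero_mem] by auto
  have "f x - f 0 \<in> K" using cone_order_isoD(2)[OF f, of 0 x] x by simp
  then show ?thesis using x K.pointed[of "f 0"] iso_mem[OF f C.zero_mem] by simp
qed

text \<open>The upper sets of \<open>x\<close> in \<open>C\<close> and of \<open>f x\<close> in
  \<open>K\<close> are the translates \<open>x + C\<close> and \<open>f x + K\<close>, and
  \<open>f\<close> matches them. Hence facts about rays from \<open>0\<close> also apply to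
  half-lines from any point of the cone.\<close>

lemma iso_translate:
  assumes f: "cone_order_iso C K f" and x: "x \<in> C"
  shows "cone_order_iso C K (\<lambda>y. f (x + y) - f x)"
proof (rule cone_order_isoI)
  show iff: "f (x + z) - f x - (f (x + y) - f x) \<in> K \<longleftrightarrow> z - y \<in> C" if "y \<in> C" "z \<in> C" for y z
    using cone_order_isoD(2)[OF f, of "x + y" "x + z"] C.add_mem x that by simp
  show "bij_betw (\<lambda>y. f (x + y) - f x) C K"
    unfolding bij_betw_def
  proof
    show "inj_on (\<lambda>y. f (x + y) - f x) C"
      using iso_eq_iff[OF f] C.add_mem x by (auto simp: inj_on_def)
    show "(\<lambda>y. f (x + y) - f x) ` C = K"
    proof
      show "(\<lambda>y. f (x + y) - f x) ` C \<subseteq> K"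
        using cone_order_isoD(2)[OF f] C.add_mem x by auto
      show "K \<subseteq> (\<lambda>y. f (x + y) - f x) ` C"
      proof
        fix k assume k: "k \<in> K"
        then obtain z where z: "z \<in> C" "f z = f x + k"
          using iso_surj[OF f K.add_mem[OF iso_mem[OF f x] k]] by auto
        then have "z - x \<in> C" using cone_order_isoD(2)[OF f x z(1)] k by simp
        then show "k \<in> (\<lambda>y. f (x + y) - f x) ` C"
          using z by (intro image_eqI[of _ _ "z - x"]) auto
      qed
    qed
  qed
qed

text \<open>The interval from \<open>0\<close> to \<open>f v\<close> is the image of the one from
  \<open>0\<close> to \<open>v\<close>, which consists of multiples of \<open>v\<close> and is a
  chain.\<close>

lemma iso_extreme:
  assumes f: "cone_order_iso C K f" and v: "extreme_vector C v"
  shows "extreme_vector K (f v)"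
proof (rule K.extreme_if_chain)
  note vC = C.extremeD[OF v]
  show "f v \<in> K" using iso_mem[OF f] vC by auto
  show "f v \<noteq> 0" using iso_eq_iff[OF f vC(1) C.zero_mem] iso_zero[OF f] vC by auto
  have ray: "\<exists>t. p = f (t *\<^sub>R v) \<and> 0 \<le> t" if p: "p \<in> K" "f v - p \<in> K" for p
  proof -
    obtain x where x: "x \<in> C" "f x = p" using iso_surj[OF f p(1)] by auto
    then have "v - x \<in> C" using cone_order_isoD(2)[OF f x(1) vC(1)] p by simp
    then show ?thesis using C.extreme_below_multiple[OF v, of x 1] x by auto
  qed
  fix p q assume "p \<in> K" "q \<in> K" "f v - p \<in> K" "f v - q \<in> K"
  then obtain s t where st: "p = f (s *\<^sub>R v)" "0 \<le> s" "q = f (t *\<^sub>R v)" "0 \<le> t"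
    using ray by meson
  have "t *\<^sub>R v - s *\<^sub>R v \<in> C \<or> s *\<^sub>R v - t *\<^sub>R v \<in> C"
    using C.scale_mem_iff[OF v] by (metis diff_ge_0_iff_ge linear scaleR_diff_left)
  then show "q - p \<in> K \<or> p - q \<in> K"
    using cone_order_isoD(2)[OF f] st C.scale_mem[OF vC(1)] by metis
qed

lemma iso_ray_image:
  assumes f: "cone_order_iso C K f" and v: "extreme_vector C v" and t: "0 \<le> t"
  shows "\<exists>s\<ge>0. f (t *\<^sub>R v) = s *\<^sub>R f v"
proof -
  note vC = C.extremeD[OF v]
  have tv: "t *\<^sub>R v \<in> C" using t by (simp add: C.scale_mem vC)
  note fv = iso_extreme[OF f v]
  show ?thesis
  proof (cases "t \<le> 1")
    case True
    then have "v - t *\<^sub>R v \<in> C"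
      using C.scale_mem[OF vC(1), of "1 - t"] by (simp add: algebra_simps)
    then have "f v - f (t *\<^sub>R v) \<in> K" using cone_order_isoD(2)[OF f tv vC(1)] by simp
    then show ?thesis
      using K.extreme_below_multiple[OF fv, of "f (t *\<^sub>R v)" 1] iso_mem[OF f tv] by simp
  \<comment> \<open>Here \<open>f (t *\<^sub>R v)\<close> is the larger vector, so its own
    extremality is used and the resulting factor is inverted.\<close>
  next
    case False
    then have "t *\<^sub>R v - v \<in> C"
      using C.scale_mem[OF vC(1), of "t - 1"] by (simp add: algebra_simps)
    then have le: "f (t *\<^sub>R v) - f v \<in> K" using cone_order_isoD(2)[OF f vC(1) tv] by simp
    have ftv: "extreme_vector K (f (t *\<^sub>R v))"
      using iso_extreme[OF f C.extreme_scale[OF v]] False by simp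
    obtain s where s: "s \<ge> 0" "f v = s *\<^sub>R f (t *\<^sub>R v)"
      using K.extreme_below_multiple[OF ftv, of "f v" 1] le K.extremeD[OF fv] by auto
    then have "s \<noteq> 0" using K.extremeD[OF fv] by auto
    then show ?thesis using s by (intro exI[of _ "1/s"]) simp
  qed
qed

lemma iso_ray:
  assumes f: "cone_order_iso C K f" and v: "extreme_vector C v"
  obtains g where "bij_betw g {0..} {0..}" "mono_on {0..} g"
    "\<And>t. 0 \<le> t \<Longrightarrow> f (t *\<^sub>R v) = g t *\<^sub>R f v"
proof -
  \<comment> \<open>With the cones exchanged, \<open>iso_ray_image\<close> applies to the inverse of
    \<open>f\<close> and yields surjectivity of \<open>g\<close>.\<close>
  interpret inv: archimedean_cone_pair K C by unfold_locales
  note fv = iso_extreme[OF f v]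
  note vC = C.extremeD[OF v]
  obtain g where g: "\<And>t. 0 \<le> t \<Longrightarrow> 0 \<le> g t \<and> f (t *\<^sub>R v) = g t *\<^sub>R f v"
    using iso_ray_image[OF f v] by metis
  have mono: "mono_on {0..} g"
  proof (rule mono_onI)
    fix r s :: real assume rs: "r \<in> {0..}" "s \<in> {0..}" "r \<le> s"
    then have "s *\<^sub>R v - r *\<^sub>R v \<in> C"
      using C.scale_mem[OF vC(1), of "s - r"] by (simp add: algebra_simps)
    then have "f (s *\<^sub>R v) - f (r *\<^sub>R v) \<in> K"
      using cone_order_isoD(2)[OF f] rs C.scale_mem[OF vC(1)] by simp
    then have "(g s - g r) *\<^sub>R f v \<in> K" using g rs by (simp add: algebra_simps)
    then show "g r \<le> g s" using K.scale_mem_iff[OF fv] by simp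
  qed
  have inj: "inj_on g {0..}"
  proof (rule inj_onI)
    fix r s :: real assume rs: "r \<in> {0..}" "s \<in> {0..}" "g r = g s"
    then have "f (r *\<^sub>R v) = f (s *\<^sub>R v)" using g by simp
    then show "r = s" using iso_eq_iff[OF f] rs C.scale_mem vC by auto
  qed
  have surj: "\<exists>t\<ge>0. g t = s" if s: "0 \<le> s" for s
  proof -
    have "inv_into C f (f v) = v" using cone_order_isoD(1)[OF f] vC by (simp add: bij_betw_def)
    moreover obtain t where t: "t \<ge> 0" "inv_into C f (s *\<^sub>R f v) = t *\<^sub>R inv_into C f (f v)"
      using inv.iso_ray_image[OF cone_order_iso_inv[OF f] fv s] by auto
    moreover have "f (inv_into C f (s *\<^sub>R f v)) = s *\<^sub>R f v"
      using cone_order_isoD(1)[OF f] K.scale_mem K.extremeD[OF fv] s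
      by (metis bij_betw_inv_into_right)
    ultimately have "g t *\<^sub>R f v = s *\<^sub>R f v" using g by metis
    then show ?thesis using t K.extremeD[OF fv] by auto
  qed
  have "bij_betw g {0..} {0..}"
    using inj g surj unfolding bij_betw_def by (auto simp: image_iff)
  then show thesis using that mono g by blast
qed

text \<open>A multiple of \<open>f v\<close> in \<open>K\<close> is already the image of a multiple
  of \<open>v\<close>, so injectivity would put \<open>u\<close> on the ray of
  \<open>v\<close>.\<close>

lemma iso_nonparallel:
  assumes f: "cone_order_iso C K f" and v: "extreme_vector C v" and u: "u \<in> C"
    and np: "\<And>t. u \<noteq> t *\<^sub>R v"
  shows "f u \<noteq> t *\<^sub>R f v"
proof
  assume eq: "f u = t *\<^sub>R f v"
  have "0 \<le> t" using iso_mem[OF f u] eq K.scale_mem_iff[OF iso_extreme[OF f v]] by simp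
  obtain g where g: "bij_betw g {0..} {0..}" "\<And>t. 0 \<le> t \<Longrightarrow> f (t *\<^sub>R v) = g t *\<^sub>R f v"
    using iso_ray[OF f v] by metis
  then obtain s where "s \<ge> 0" "g s = t" using \<open>0 \<le> t\<close> by (metis atLeast_iff bij_betw_iff_bijections)
  then have "f (s *\<^sub>R v) = f u" using g eq by simp
  then show False using iso_eq_iff[OF f] u np C.scale_mem C.extremeD[OF v] \<open>s \<ge> 0\<close> by metis
qed

section \<open>Additivity on two non-parallel extreme vectors\<close>

text \<open>Otherwise \<open>a\<close>, \<open>b\<close> and \<open>w 1\<close> are independent, and
  the rulings over \<open>0\<close>, \<open>u\<close> and \<open>2 u\<close> force \<open>b\<close>
  to be parallel to \<open>w 2\<close>, although \<open>w 2\<close> has a nonzero \<open>w 1\<close>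
  component. The value of the factor is settled in \<open>iso_add\<close>.\<close>

lemma iso_add_parallel:
  assumes f: "cone_order_iso C K f" and u: "extreme_vector C u" and v: "extreme_vector C v"
    and np: "\<And>t. u \<noteq> t *\<^sub>R v"
  shows "\<exists>k. f (u + v) - f u = k *\<^sub>R f v"
proof (rule ccontr)
  assume "\<nexists>k. f (u + v) - f u = k *\<^sub>R f v"
  define a where "a = f u"
  define b where "b = f v"
  \<comment> \<open>\<open>w r\<close> spans the image of the half-line from \<open>r u\<close> in
    direction \<open>v\<close>, seen from \<open>f (r u)\<close>; \<open>w 0\<close> is
    \<open>b\<close>.\<close>
  define w where "w = (\<lambda>r. f (r *\<^sub>R u + v) - f (r *\<^sub>R u))"
  have wb: "w 1 \<noteq> t *\<^sub>R b" for t
    using \<open>\<nexists>k. f (u + v) - f u = k *\<^sub>R f v\<close> by (auto simp: w_def b_def)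
  note uC = C.extremeD[OF u] and vC = C.extremeD[OF v]
  have np': "v \<noteq> t *\<^sub>R u" for t using np C.parallel_sym vC by metis
  have ab: "a \<noteq> t *\<^sub>R b" for t
    unfolding a_def b_def by (rule iso_nonparallel[OF f v uC(1) np])
  have ea: "extreme_vector K a" and eb: "extreme_vector K b"
    unfolding a_def b_def using iso_extreme[OF f] u v by auto
  have ew: "extreme_vector K (w r)" if "0 \<le> r" for r
    using iso_extreme[OF iso_translate[OF f C.scale_mem[OF uC(1) that]] v] by (simp add: w_def)
  have aw: "w 1 \<noteq> t *\<^sub>R a" for t
  proof
    assume "w 1 = t *\<^sub>R a"
    then have "f (u + v) = (1 + t) *\<^sub>R f u" by (simp add: w_def a_def algebra_simps)
    moreover have "u + v \<noteq> s *\<^sub>R u" for s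
      using np'[of "s - 1"] by (auto simp: algebra_simps)
    ultimately show False using iso_nonparallel[OF f u C.add_mem[OF uC(1) vC(1)]] by blast
  qed
  have aw': "a \<noteq> t *\<^sub>R w 1" and bw': "b \<noteq> t *\<^sub>R w 1" for t
    using aw wb K.parallel_sym K.extremeD[OF ea] K.extremeD[OF eb] by metis+
  \<comment> \<open>The three image directions are independent, which allows coefficients to be
    compared below.\<close>
  note indep = K.extreme_triple_independent[OF ea eb ew[of 1] ab aw' bw', simplified]
  obtain \<rho> where \<rho>: "bij_betw \<rho> {0..} {0..}" "mono_on {0..} \<rho>"
      "\<And>t. 0 \<le> t \<Longrightarrow> f (t *\<^sub>R u) = \<rho> t *\<^sub>R a"
    using iso_ray[OF f u] unfolding a_def by metis
  have \<rho>1: "\<rho> 1 = 1" using \<rho>(3)[of 1] K.extremeD[OF ea] scaleR_cancel_right[of "\<rho> 1" a 1] by (simp add: a_def)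
  \<comment> \<open>\<open>f (2 u) = r a\<close> is the base point of the third ruling;
    \<open>r > 1\<close> since \<open>\<rho>\<close> is monotone and injective.\<close>
  define r where "r = \<rho> 2"
  have "r \<noteq> 1" using \<rho>(1) \<rho>1 by (auto simp: r_def bij_betw_def dest!: inj_onD[of _ _ 1 2])
  moreover have "r \<ge> \<rho> 1" using \<rho>(2) by (auto simp: r_def mono_on_def)
  ultimately have r: "r > 1" using \<rho>1 by simp
  obtain s where s: "bij_betw s {0..} {0..}" "\<And>t. 0 \<le> t \<Longrightarrow> f (t *\<^sub>R v) = s t *\<^sub>R b"
    using iso_ray[OF f v] unfolding b_def by metis
  have "\<exists>h. bij_betw h {0..} {0..} \<and> (\<forall>t\<ge>0. f (l *\<^sub>R u + t *\<^sub>R v) - f (l *\<^sub>R u) = h t *\<^sub>R w l)"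
    if "0 \<le> l" for l
    using iso_ray[OF iso_translate[OF f C.scale_mem[OF uC(1) that]] v] unfolding w_def by metis
  then obtain h where h: "\<And>l. 0 \<le> l \<Longrightarrow> bij_betw (h l) {0..} {0..}"
    "\<And>l t. 0 \<le> l \<Longrightarrow> 0 \<le> t \<Longrightarrow> f (l *\<^sub>R u + t *\<^sub>R v) - f (l *\<^sub>R u) = h l t *\<^sub>R w l"
    by metis
  have f1: "f (u + t *\<^sub>R v) = a + h 1 t *\<^sub>R w 1" if "0 \<le> t" for t
    using h(2)[of 1 t] that by (simp add: a_def algebra_simps)
  have f2: "f (2 *\<^sub>R u + t *\<^sub>R v) = r *\<^sub>R a + h 2 t *\<^sub>R w 2" if "0 \<le> t" for t
    using h(2)[of 2 t] that \<rho>(3)[of 2] by (simp add: r_def algebra_simps)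
  have h1: "h l 1 = 1" if "0 \<le> l" for l
  proof -
    have "h l 1 *\<^sub>R w l = w l" using h(2)[OF that, of 1] by (simp add: w_def)
    then show ?thesis using K.extremeD[OF ew[OF that]] scaleR_cancel_right[of "h l 1" "w l" 1] by simp
  qed
  text \<open>The points \<open>f (t v)\<close>, \<open>f (u + t v)\<close> and \<open>f (2 u + t v)\<close> are collinear, since they lie
    on the image of the extreme half-line from \<open>t v\<close> in direction \<open>u\<close>.\<close>
  have "\<exists>c>1. f (2 *\<^sub>R u + t *\<^sub>R v) - s t *\<^sub>R b = c *\<^sub>R (f (u + t *\<^sub>R v) - s t *\<^sub>R b)" if t: "0 \<le> t" for t
  proof -
    have "t *\<^sub>R v \<in> C" using C.scale_mem vC t by auto
    note G = iso_translate[OF f this]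
    define w' where "w' = f (t *\<^sub>R v + u) - f (t *\<^sub>R v)"
    obtain k where k: "bij_betw k {0..} {0..}" "mono_on {0..} k"
      "\<And>l. 0 \<le> l \<Longrightarrow> f (t *\<^sub>R v + l *\<^sub>R u) - f (t *\<^sub>R v) = k l *\<^sub>R w'"
      using iso_ray[OF G u] unfolding w'_def by metis
    have "w' \<noteq> 0" using K.extremeD[OF iso_extreme[OF G u]] by (simp add: w'_def)
    then have k1: "k 1 = 1" using k(3)[of 1] scaleR_cancel_right[of "k 1" w' 1] by (simp add: w'_def)
    have "k 2 \<noteq> k 1" using k(1) by (auto simp: bij_betw_def dest!: inj_onD[of _ _ 2 1])
    moreover have "k 1 \<le> k 2" using k(2) by (auto simp: mono_on_def)
    ultimately have "k 2 > 1" using k1 by simp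
    moreover have "f (2 *\<^sub>R u + t *\<^sub>R v) - s t *\<^sub>R b = k 2 *\<^sub>R (f (u + t *\<^sub>R v) - s t *\<^sub>R b)"
      using k(3)[of 2] s(2)[OF t] by (simp add: w'_def add.commute)
    ultimately show ?thesis by blast
  qed
  then obtain c where c: "\<And>t. 0 \<le> t \<Longrightarrow> 1 < c t" and
    "\<And>t. 0 \<le> t \<Longrightarrow> f (2 *\<^sub>R u + t *\<^sub>R v) - s t *\<^sub>R b = c t *\<^sub>R (f (u + t *\<^sub>R v) - s t *\<^sub>R b)"
    by metis
  then have col: "r *\<^sub>R a + h 2 t *\<^sub>R w 2 - s t *\<^sub>R b = c t *\<^sub>R (a + h 1 t *\<^sub>R w 1 - s t *\<^sub>R b)"
    if "0 \<le> t" for t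
    using f1 f2 that by metis
  \<comment> \<open>\<open>\<alpha>\<close> and \<open>\<beta>\<close> are read off from
    \<open>col\<close> at \<open>t = 1\<close>, where \<open>h 1 1 = h 2 1 = s 1 = 1\<close>; this
    expands \<open>w 2\<close> in \<open>a\<close>, \<open>b\<close>, \<open>w 1\<close>.\<close>
  define \<alpha> where "\<alpha> = c 1 - r"
  define \<beta> where "\<beta> = (c 1 - 1) * s 1"
  have s1: "s 1 = 1" using s(2)[of 1] K.extremeD[OF eb] scaleR_cancel_right[of "s 1" b 1] by (simp add: b_def)
  have w2: "w 2 = \<alpha> *\<^sub>R a - \<beta> *\<^sub>R b + c 1 *\<^sub>R w 1"
    using col[of 1] h1 by (simp add: \<alpha>_def \<beta>_def s1 algebra_simps)
  have \<beta>: "\<beta> > 0" using c[of 1] by (simp add: \<beta>_def s1)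
  have rel: "c t = r + \<alpha> * h 2 t" "(c t - 1) * s t = \<beta> * h 2 t" if t: "0 \<le> t" for t
  proof -
    have "(r + \<alpha> * h 2 t - c t) *\<^sub>R a + ((c t - 1) * s t - \<beta> * h 2 t) *\<^sub>R b
        + (h 2 t * c 1 - c t * h 1 t) *\<^sub>R w 1 = 0"
      using col[OF t] unfolding w2 by (simp add: algebra_simps)
    from indep[OF this] show "c t = r + \<alpha> * h 2 t" "(c t - 1) * s t = \<beta> * h 2 t" by auto
  qed
  have s_surj: "\<exists>t\<ge>0. s t = y" if "0 \<le> y" for y
    using s(1) that by (metis atLeast_iff bij_betw_iff_bijections)
  have h_surj: "\<exists>t\<ge>0. h 2 t = y" if "0 \<le> y" for y
    using h(1)[of 2] that by (metis atLeast_iff bij_betw_iff_bijections zero_le_numeral)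
  text \<open>By \<open>rel\<close>, \<open>s t\<close> is a Moebius function of \<open>h 2 t\<close>; as both are onto \<open>[0, \<infinity>)\<close>, it is linear.\<close>
  have \<alpha>0: "\<alpha> = 0"
  proof (rule ccontr)
    assume "\<alpha> \<noteq> 0"
    show False
    proof (cases "\<alpha> > 0")
      \<comment> \<open>\<open>\<beta> / \<alpha>\<close> is the limit of the Moebius function at
        infinity. It cannot be attained at a finite argument.\<close>
      case True
      then have "0 \<le> \<beta> / \<alpha>" using \<beta> by simp
      then obtain t where t: "t \<ge> 0" "s t = \<beta> / \<alpha>" using s_surj by blast
      have "(r + \<alpha> * h 2 t - 1) * (\<beta> / \<alpha>) = \<beta> * h 2 t" using rel[OF t(1)] t by simp
      then have "(r - 1) * (\<beta> / \<alpha>) = 0" using True by (simp add: field_simps)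
      then show False using True r \<beta> by simp
    next
      \<comment> \<open>For negative \<open>\<alpha>\<close> the value
        \<open>r / (- \<alpha>)\<close> of \<open>h 2\<close> would make \<open>c t\<close> vanish,
        against \<open>c t > 1\<close>.\<close>
      case False
      then have "0 \<le> r / (- \<alpha>)" using r \<open>\<alpha> \<noteq> 0\<close> by (simp add: field_simps)
      then obtain t where t: "t \<ge> 0" "h 2 t = r / (- \<alpha>)" using h_surj by blast
      then show False using rel(1)[OF t(1)] c[OF t(1)] \<open>\<alpha> \<noteq> 0\<close> by simp
    qed
  qed
  \<comment> \<open>With \<open>\<alpha> = 0\<close>, \<open>rel\<close> reads
    \<open>c t = r\<close> and \<open>(r - 1) * s t = \<beta> * h 2 t\<close>, so \<open>k\<close>
    is the slope of \<open>h 2\<close> against \<open>s\<close>.\<close>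
  define k where "k = (r - 1) / \<beta>"
  have k: "k > 0" using r \<beta> by (simp add: k_def)
  have hs: "h 2 t = k * s t" if "0 \<le> t" for t
    using rel[OF that] \<alpha>0 \<beta> by (simp add: k_def field_simps)
  have ra: "r *\<^sub>R a \<in> K" using K.scale_mem K.extremeD[OF ea] r by simp
  \<comment> \<open>Since \<open>t v \<le> 2 u + t v\<close>, choosing \<open>s t = n\<close> bounds
    \<open>n (b - k w 2)\<close> by the fixed vector \<open>r a\<close>. Then \<open>b\<close> lies
    below \<open>k w 2\<close>, and extremality of \<open>w 2\<close> makes them parallel.\<close>
  have "- (b - k *\<^sub>R w 2) \<in> K"
  proof (rule K.archimedean[OF ra])
    fix n :: nat
    obtain t where t: "t \<ge> 0" "s t = real n" using s_surj[of "real n"] by auto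
    have "2 *\<^sub>R u + t *\<^sub>R v \<in> C" "t *\<^sub>R v \<in> C" "2 *\<^sub>R u + t *\<^sub>R v - t *\<^sub>R v \<in> C"
      using C.add_mem C.scale_mem uC vC t by auto
    then have "f (2 *\<^sub>R u + t *\<^sub>R v) - f (t *\<^sub>R v) \<in> K" using cone_order_isoD(2)[OF f] by metis
    then show "r *\<^sub>R a - real n *\<^sub>R (b - k *\<^sub>R w 2) \<in> K"
      using f2[OF t(1)] s(2)[OF t(1)] hs[OF t(1)] t(2) by (simp add: algebra_simps)
  qed
  then obtain q where q: "b = q *\<^sub>R w 2"
    using K.extreme_below_multiple[OF ew[of 2], of b k] k K.extremeD[OF eb] by auto
  then have "q \<noteq> 0" using K.extremeD[OF eb] by auto
  \<comment> \<open>Scaling the expansion of \<open>w 2\<close> by \<open>q\<close> expresses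
    \<open>b\<close> through \<open>b\<close> and \<open>w 1\<close>; the coefficient
    \<open>q * c 1\<close> of \<open>w 1\<close> is not zero.\<close>
  have "0 *\<^sub>R a + (- q * \<beta> - 1) *\<^sub>R b + (q * c 1) *\<^sub>R w 1 = 0"
    using arg_cong[OF w2, of "\<lambda>x. q *\<^sub>R x"] q[symmetric] \<alpha>0 by (simp add: algebra_simps)
  from indep[OF this] show False using \<open>q \<noteq> 0\<close> c[of 1] by auto
qed

text \<open>Exchanging \<open>u\<close> and \<open>v\<close> gives a second expansion of
  \<open>f (u + v)\<close>; as \<open>f u\<close> and \<open>f v\<close> are not parallel, the
  coefficients agree.\<close>

lemma iso_add:
  assumes f: "cone_order_iso C K f" and u: "extreme_vector C u" and v: "extreme_vector C v"
    and np: "\<And>t. u \<noteq> t *\<^sub>R v"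
  shows "f (u + v) = f u + f v"
proof -
  have np': "v \<noteq> t *\<^sub>R u" for t using np C.parallel_sym C.extremeD[OF v] by metis
  obtain k where k: "f (u + v) = f u + k *\<^sub>R f v"
    using iso_add_parallel[OF f u v np] by (metis add_diff_cancel_left' diff_add_cancel add.commute)
  obtain l where l: "f (v + u) = f v + l *\<^sub>R f u"
    using iso_add_parallel[OF f v u np'] by (metis add_diff_cancel_left' diff_add_cancel add.commute)
  have eq: "(1 - l) *\<^sub>R f u = (1 - k) *\<^sub>R f v"
    using k l by (simp add: algebra_simps)
  have "l = 1"
  proof (rule ccontr)
    assume "l \<noteq> 1"
    have "(1 / (1 - l)) *\<^sub>R (1 - l) *\<^sub>R f u = ((1 - k) / (1 - l)) *\<^sub>R f v" unfolding eq by simp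
    then have "f u = ((1 - k) / (1 - l)) *\<^sub>R f v" using \<open>l \<noteq> 1\<close> by simp
    then show False using iso_nonparallel[OF f v _ np] C.extremeD[OF u] by blast
  qed
  then show ?thesis using l by (simp add: add.commute)
qed

lemma iso_add_scaled:
  assumes f: "cone_order_iso C K f" and u: "extreme_vector C u" and v: "extreme_vector C v"
    and np: "\<And>t. u \<noteq> t *\<^sub>R v" and st: "0 \<le> s" "0 \<le> t"
  shows "f (s *\<^sub>R u + t *\<^sub>R v) = f (s *\<^sub>R u) + f (t *\<^sub>R v)"
proof (cases "s = 0 \<or> t = 0")
  case True
  then show ?thesis using iso_zero[OF f] by auto
next
  case False
  have "s *\<^sub>R u \<noteq> r *\<^sub>R t *\<^sub>R v" for r
  proof
    assume "s *\<^sub>R u = r *\<^sub>R t *\<^sub>R v"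
    then have "(1/s) *\<^sub>R s *\<^sub>R u = (r * t / s) *\<^sub>R v" by simp
    then show False using np False by auto
  qed
  then show ?thesis using iso_add[OF f C.extreme_scale[OF u] C.extreme_scale[OF v]] False st by simp
qed

section \<open>Finite sums and the choice of the functions \<open>g\<close>\<close>

text \<open>The induction keeps \<open>f\<close> arbitrary because the hypothesis is applied to the
  translate \<open>F\<close> by the new summand. By the two-vector case \<open>F\<close> agrees with
  \<open>f\<close> on each remaining summand.\<close>

lemma iso_sum:
  assumes "finite I" "cone_order_iso C K f"
    and "\<And>i. i \<in> I \<Longrightarrow> extreme_vector C (v i)"
    and "\<And>i j t. i \<in> I \<Longrightarrow> j \<in> I \<Longrightarrow> i \<noteq> j \<Longrightarrow> v i \<noteq> t *\<^sub>R v j"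
    and "\<And>i. i \<in> I \<Longrightarrow> 0 \<le> l i"
  shows "f (\<Sum>i\<in>I. l i *\<^sub>R v i) = (\<Sum>i\<in>I. f (l i *\<^sub>R v i))"
  using assms
proof (induction I arbitrary: f rule: finite_induct)
  case empty
  then show ?case using iso_zero by simp
next
  case (insert j I)
  define F where "F = (\<lambda>y. f (l j *\<^sub>R v j + y) - f (l j *\<^sub>R v j))"
  have "l j *\<^sub>R v j \<in> C" using C.scale_mem C.extremeD(1) insert.prems by simp
  then have "cone_order_iso C K F" unfolding F_def by (rule iso_translate[OF insert.prems(1)])
  then have "F (\<Sum>i\<in>I. l i *\<^sub>R v i) = (\<Sum>i\<in>I. F (l i *\<^sub>R v i))"
    by (rule insert.IH) (use insert.prems in auto)
  also have "\<dots> = (\<Sum>i\<in>I. f (l i *\<^sub>R v i))"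
  proof (rule sum.cong[OF refl])
    fix i assume "i \<in> I"
    then have "f (l j *\<^sub>R v j + l i *\<^sub>R v i) = f (l j *\<^sub>R v j) + f (l i *\<^sub>R v i)"
      using insert.hyps by (intro iso_add_scaled insert.prems) auto
    then show "F (l i *\<^sub>R v i) = f (l i *\<^sub>R v i)" by (simp add: F_def)
  qed
  finally show ?case using insert.hyps by (simp add: F_def algebra_simps)
qed

end

text \<open>This brings independence into the pairwise form that \<open>iso_sum\<close>
  takes.\<close>

lemma independent_family_nonparallel:
  assumes "independent_family A v" "a \<in> A" "b \<in> A" "a \<noteq> b"
  shows "v a \<noteq> t *\<^sub>R v b"
proof
  assume eq: "v a = t *\<^sub>R v b"
  have "v b \<in> v ` A - {v a}" "independent (v ` A)" "v a \<in> v ` A"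
    using assms by (auto simp: independent_family_def inj_on_def)
  then show False
    unfolding dependent_def by (metis eq span_base span_scale)
qed

theorem proposition5p1:
  fixes C :: "'a::real_vector set" and K :: "'b::real_vector set"
    and f :: "'a \<Rightarrow> 'b" and A :: "'i set" and v :: "'i \<Rightarrow> 'a"
  assumes "partially_ordered_vs C" and "archimedean_vs C"
    and "partially_ordered_vs K" and "archimedean_vs K"
    and "cone_order_iso C K f"
    and "\<And>a. a \<in> A \<Longrightarrow> extreme_vector C (v a)"
    and "independent_family A v"
  shows "\<exists>g :: 'i \<Rightarrow> real \<Rightarrow> real.
    (\<forall>a\<in>A. bij_betw (g a) {0..} {0..} \<and> mono_on {0..} (g a)) \<and>
    (\<forall>(n::nat) (l :: nat \<Rightarrow> real) (\<alpha> :: nat \<Rightarrow> 'i).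
      (\<forall>i\<in>{1..n}. l i \<ge> 0) \<longrightarrow> \<alpha> ` {1..n} \<subseteq> A \<longrightarrow> inj_on \<alpha> {1..n} \<longrightarrow>
      f (\<Sum>i=1..n. l i *\<^sub>R v (\<alpha> i)) = (\<Sum>i=1..n. g (\<alpha> i) (l i) *\<^sub>R f (v (\<alpha> i))))"
proof -
  interpret archimedean_cone_pair C K
    by unfold_locales (use assms in auto)
  \<comment> \<open>One function is chosen for each index before any sum is fixed, so it depends on
    the ray alone.\<close>
  have "\<exists>g. bij_betw g {0..} {0..} \<and> mono_on {0..} g \<and>
      (\<forall>t\<ge>0. f (t *\<^sub>R v a) = g t *\<^sub>R f (v a))" if "a \<in> A" for a
    using iso_ray[OF assms(5) assms(6)[OF that]] by metis
  then obtain g where g: "\<And>a. a \<in> A \<Longrightarrow> bij_betw (g a) {0..} {0..} \<and> mono_on {0..} (g a)"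
    "\<And>a t. a \<in> A \<Longrightarrow> 0 \<le> t \<Longrightarrow> f (t *\<^sub>R v a) = g a t *\<^sub>R f (v a)"
    by metis
  show ?thesis
  proof (intro exI[of _ g] conjI ballI allI impI)
    fix n :: nat and l :: "nat \<Rightarrow> real" and \<alpha> :: "nat \<Rightarrow> 'i"
    assume l: "\<forall>i\<in>{1..n}. l i \<ge> 0" and \<alpha>: "\<alpha> ` {1..n} \<subseteq> A" "inj_on \<alpha> {1..n}"
    have "f (\<Sum>i=1..n. l i *\<^sub>R v (\<alpha> i)) = (\<Sum>i=1..n. f (l i *\<^sub>R v (\<alpha> i)))"
    proof (rule iso_sum[OF _ assms(5)])
      fix i j t assume "i \<in> {1..n}" "j \<in> {1..n}" "i \<noteq> j"
      then show "v (\<alpha> i) \<noteq> t *\<^sub>R v (\<alpha> j)"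
        using \<alpha> by (intro independent_family_nonparallel[OF assms(7)]) (auto dest: inj_onD)
    qed (use l \<alpha> in \<open>auto intro!: assms(6)\<close>)
    also have "\<dots> = (\<Sum>i=1..n. g (\<alpha> i) (l i) *\<^sub>R f (v (\<alpha> i)))"
      by (rule sum.cong) (use l \<alpha> in \<open>auto intro!: g(2)\<close>)
    finally show "f (\<Sum>i=1..n. l i *\<^sub>R v (\<alpha> i)) = (\<Sum>i=1..n. g (\<alpha> i) (l i) *\<^sub>R f (v (\<alpha> i)))" .
  qed (use g(1) in auto)
qed

end
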